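(* Let $X$ be a real Hilbert space, let $\alpha\in\mathbb{R}\smallsetminus\{0\}$, $\beta>0$, and set $S:=\{(\mathbf{x},\mathbf{y},\gamma)\in X\times X\times\mathbb{R} : \langle\mathbf{x},\mathbf{y}\rangle=\alpha\gamma\}$. Suppose $\mathbf{z}\in X\smallsetminus\{0\}$, set $\zeta:=\|\mathbf{z}\|>0$, let $\gamma\in\mathbb{R}$, and assume that $$\alpha(\gamma+\alpha/\beta^2)>\zeta^2/4.$$ Set $$p:=-\frac{(\beta^2\gamma-\alpha)^2}{3\alpha^2},\qquad q:=\frac{2(\beta^2\gamma-\alpha)^3}{27\alpha^3}-\frac{\beta^2\zeta^2}{\alpha^2},$$ $$\Delta:=(p/3)^3+(q/2)^2=\frac{\beta^2\zeta^2}{\alpha^2}\Big(\frac{\beta^2\zeta^2}{4\alpha^2}-\frac{(\beta^2\gamma-\alpha)^3}{27\alpha^3}\Big).$$ If $\Delta\geq0$, then set $$x:=-\frac{2\alpha+\beta^2\gamma}{3\alpha}+\sqrt[3]{\frac{-q}{2}+\sqrt{\Delta}}+\sqrt[3]{\frac{-q}{2}-\sqrt{\Delta}};$$ and if $\Delta<0$, then set $$x:=-\frac{2\alpha+\beta^2\gamma}{3\alpha}+\delta\,\frac{2(\alpha-\beta^2\gamma)}{3\alpha}\cos\bigg(\frac13\Big((2+2\delta)\pi+\arccos\frac{-q/2}{(-p/3)^{3/2}}\Big)\bigg),$$ where $\delta:=\operatorname{sign}(\alpha^2-\alpha\beta^2\gamma)\in\{-1,0,1\}$. Then $-1<x<1$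 and $$P_S(\mathbf{z},\mathbf{z},\gamma)=\Big(\frac{\mathbf{z}}{1+x},\frac{\mathbf{z}}{1+x},\gamma+\frac{\alpha x}{\beta^2}\Big).$$
   Context: The space $X\times X\times\mathbb{R}$ carries the Hilbert product norm $\|(\mathbf{x},\mathbf{y},\gamma)\|:=\sqrt{\|\mathbf{x}\|^2+\|\mathbf{y}\|^2+\beta^2\gamma^2}$, and $P_S$ is the projection onto the (nonconvex) set $S$ with respect to this norm: $P_S(w)$ is the set of nearest points of $S$ to $w$; writing $P_S(w)=s$ means that $s$ is the unique nearest point. For real $t$, $\sqrt[3]{t}$ denotes the unique real cube root of $t$ (also for negative $t$). $\arccos$ takes values in $[0,\pi]$; $\operatorname{sign}(0)=0$. *)

theory Defs
  imports "HOL-Analysis.Analysis"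
begin

text \<open>
  The product type \<open>'a \<times> 'a \<times> real\<close> already carries the unweighted norm
  (instance \<open>prod :: real_inner\<close>); the weight \<open>\<beta>\<^sup>2\<close> on the last component
  makes a separate norm necessary.
\<close>

definition wnorm :: "real \<Rightarrow> 'a::real_inner \<times> 'a \<times> real \<Rightarrow> real" where
  "wnorm \<beta> = (\<lambda>(x, y, \<gamma>). sqrt ((norm x)\<^sup>2 + (norm y)\<^sup>2 + \<beta>\<^sup>2 * \<gamma>\<^sup>2))"

definition hyp_paraboloid :: "real \<Rightarrow> ('a::real_inner \<times> 'a \<times> real) set" where
  "hyp_paraboloid \<alpha> = {(x, y, \<gamma>). inner x y = \<alpha> * \<gamma>}"

text \<open>
  The projection is set-valued, as the sets in question need not be convex. Thus
  \<open>wproj \<beta> S w = {s}\<close> says that \<open>s\<close> is the unique nearest point of \<open>S\<close> to \<open>w\<close>.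
\<close>

definition wproj ::
    "real \<Rightarrow> ('a::real_inner \<times> 'a \<times> real) set \<Rightarrow> 'a \<times> 'a \<times> real \<Rightarrow> ('a \<times> 'a \<times> real) set" where
  "wproj \<beta> S w = {s \<in> S. \<forall>t\<in>S. wnorm \<beta> (w - s) \<le> wnorm \<beta> (w - t)}"

end

theory Submission
  imports Defs
begin

text \<open>
  Write \<open>c = \<beta>\<^sup>2 \<zeta>\<^sup>2 / \<alpha>\<^sup>2\<close>, \<open>h = (\<beta>\<^sup>2 \<gamma> / \<alpha> - 1) / 3\<close> and \<open>u = 1 + x\<close>. The candidate
  point lies on the paraboloid iff \<open>u\<close> solves the cubic \<open>u\<^sup>2 (u + 3 h) = c\<close>. On the set where
  \<open>u > 0\<close> and \<open>u + 3 h > 0\<close> the left-hand side is increasing, and the hypothesis of the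
  theorem says that it exceeds \<open>c\<close> at \<open>u = 2\<close>; so a positive root satisfies \<open>u < 2\<close>, that is
  \<open>-1 < x < 1\<close>.

  Substituting \<open>u = t - h\<close> depresses the cubic to \<open>t\<^sup>3 + p t + q = 0\<close> with \<open>p = -3 h\<^sup>2\<close>,
  \<open>q = 2 h\<^sup>3 - c\<close> and discriminant term \<open>\<Delta> = c (c / 4 - h\<^sup>3)\<close>. For \<open>\<Delta> \<ge> 0\<close> Cardano's formula
  gives a root, and for \<open>\<Delta> < 0\<close>, where \<open>h > 0\<close> and hence \<open>\<delta> = -1\<close>, the trigonometric formula
  does. It remains to see that the formulas select the root with \<open>u > 0\<close>
  (\<open>cardano_shifted_root\<close>, \<open>trigonometric_shifted_root\<close>).

  For optimality, the candidate is a critical point with Lagrange multiplier \<open>x\<close>. A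
  displacement \<open>(d, e, k)\<close> that stays on the paraboloid changes the squared distance by exactly
  \<open>\<parallel>d\<parallel>\<^sup>2 + \<parallel>e\<parallel>\<^sup>2 + 2 x \<langle>d, e\<rangle> + \<beta>\<^sup>2 k\<^sup>2\<close>. Since \<open>\<bar>x\<bar> < 1\<close> this form is positive definite, so
  the candidate is the only nearest point (\<open>wproj_hyp_paraboloid_eq_singleton\<close>).
\<close>

section \<open>The positive root of the cubic\<close>

lemma cardano_root:
  fixes p q \<Delta> :: real
  assumes "\<Delta> = (p / 3)^3 + (q / 2)\<^sup>2" and "\<Delta> \<ge> 0"
  defines "a \<equiv> root 3 (- q / 2 + sqrt \<Delta>)" and "b \<equiv> root 3 (- q / 2 - sqrt \<Delta>)"
  shows "a * b = - p / 3" and "(a + b)^3 + p * (a + b) + q = 0"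
proof -
  have "(- q / 2 + sqrt \<Delta>) * (- q / 2 - sqrt \<Delta>) = (q / 2)\<^sup>2 - (sqrt \<Delta>)\<^sup>2"
    by (simp add: power2_eq_square algebra_simps)
  also have "\<dots> = (- p / 3)^3"
    using assms by (simp add: power_divide)
  finally have "a * b = root 3 ((- p / 3)^3)"
    unfolding a_def b_def by (simp only: real_root_mult [symmetric])
  then show ab: "a * b = - p / 3"
    by (simp add: odd_real_root_power_cancel del: power_minus_odd)
  have "a^3 = - q / 2 + sqrt \<Delta>" "b^3 = - q / 2 - sqrt \<Delta>"
    unfolding a_def b_def by (simp_all add: odd_real_root_pow)
  then have "a^3 + b^3 = - q"
    by simp
  moreover have "p = - 3 * (a * b)"
    using ab by simp
  ultimately show "(a + b)^3 + p * (a + b) + q = 0"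
    by algebra
qed

lemma depressed_cubic_shift:
  fixes t h c :: real
  shows "(t - h)\<^sup>2 * (t - h + 3 * h) - c = t^3 + (- 3 * h\<^sup>2) * t + (2 * h^3 - c)"
  by algebra

text \<open>
  The two radicals \<open>a\<close>, \<open>b\<close> have product \<open>h\<^sup>2\<close>. A nonnegative discriminant means
  \<open>4 h\<^sup>3 \<le> c\<close>, which makes \<open>a\<close> positive and so \<open>b\<close> nonnegative; then \<open>a + b \<ge> 2 \<bar>h\<bar>\<close> by the
  inequality of the means, which puts \<open>a + b\<close> to the right of \<open>h\<close>.
\<close>

lemma cardano_shifted_root:
  fixes c h \<Delta> :: real
  assumes "c > 0" and \<Delta>: "\<Delta> = c * (c / 4 - h^3)" and "\<Delta> \<ge> 0"
    and u: "u = root 3 (c / 2 - h^3 + sqrt \<Delta>) + root 3 (c / 2 - h^3 - sqrt \<Delta>) - h"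
  shows "u > 0" and "u\<^sup>2 * (u + 3 * h) = c"
proof -
  define p where "p = - 3 * h\<^sup>2"
  define q where "q = 2 * h^3 - c"
  define a where "a = root 3 (- q / 2 + sqrt \<Delta>)"
  define b where "b = root 3 (- q / 2 - sqrt \<Delta>)"
  have "(p / 3)^3 = - (h^3)\<^sup>2"
    by (simp add: p_def power_mult [symmetric])
  then have disc: "\<Delta> = (p / 3)^3 + (q / 2)\<^sup>2"
    unfolding \<Delta> q_def by (simp add: power2_eq_square field_simps)
  have half_q: "- q / 2 = c / 2 - h^3"
    by (simp add: q_def)
  have u_eq: "u = a + b - h"
    unfolding u a_def b_def half_q by simp
  note cardano = cardano_root [OF disc \<open>\<Delta> \<ge> 0\<close>, folded a_def b_def]
  have ab: "a * b = h\<^sup>2"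
    using cardano(1) by (simp add: p_def)
  have "h^3 \<le> c / 4"
    using \<open>c > 0\<close> \<open>\<Delta> \<ge> 0\<close> unfolding \<Delta> by (simp add: zero_le_mult_iff)
  then have "- q / 2 + sqrt \<Delta> > 0"
    using \<open>c > 0\<close> real_sqrt_ge_zero [OF \<open>\<Delta> \<ge> 0\<close>] unfolding half_q by linarith
  then have "a > 0"
    by (simp add: a_def)
  moreover have "b \<ge> 0"
    using ab \<open>a > 0\<close> by (metis zero_le_mult_iff zero_le_power2 not_less)
  moreover have "(2 * h)\<^sup>2 \<le> (a + b)\<^sup>2"
    using ab zero_le_power2 [of "a - b"] by (simp add: power2_eq_square algebra_simps)
  ultimately have "\<bar>2 * h\<bar> \<le> a + b" and "a + b > 0"
    using abs_le_square_iff [of "2 * h" "a + b"] by simp_all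
  then show "u > 0"
    unfolding u_eq by linarith
  show "u\<^sup>2 * (u + 3 * h) = c"
    using cardano(2) depressed_cubic_shift [of "a + b" h c]
    unfolding u_eq p_def q_def by simp
qed

text \<open>
  With three real roots, one third of the arc cosine lies below \<open>\<pi> / 3\<close>, so its cosine exceeds
  \<open>1 / 2\<close> and the branch chosen here lies to the right of \<open>h\<close>. It is a root by the
  triple-angle formula.
\<close>

lemma trigonometric_shifted_root:
  fixes c h :: real
  assumes "c > 0" and "c < 4 * h^3" and "h > 0"
    and u: "u = 2 * h * cos (arccos (c / (2 * h^3) - 1) / 3) - h"
  shows "u > 0" and "u\<^sup>2 * (u + 3 * h) = c"
proof -
  define v where "v = c / (2 * h^3) - 1"
  define \<theta> where "\<theta> = arccos v / 3"
  have "h^3 > 0"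
    using \<open>h > 0\<close> by simp
  then have v: "- 1 < v" "v < 1"
    using assms(1,2) by (simp_all add: v_def field_simps)
  have "0 < \<theta>" "\<theta> < pi / 3"
    using arccos_lt_bounded [OF v] by (simp_all add: \<theta>_def)
  then have "cos (pi / 3) < cos \<theta>"
    by (intro cos_monotone_0_pi) auto
  then have "1 / 2 < cos \<theta>"
    by (simp add: cos_60)
  with \<open>h > 0\<close> have "0 < h * (2 * cos \<theta> - 1)"
    by simp
  then show "u > 0"
    unfolding u v_def [symmetric] \<theta>_def [symmetric] by (simp add: algebra_simps)
  have "4 * cos \<theta>^3 - 3 * cos \<theta> = cos (3 * \<theta>)"
    by (simp add: cos_treble_cos)
  also have "\<dots> = v"
    using v by (simp add: \<theta>_def)
  finally have "4 * cos \<theta>^3 - 3 * cos \<theta> = v" .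
  then have "2 * h^3 * (4 * cos \<theta>^3 - 3 * cos \<theta>) = c - 2 * h^3"
    using \<open>h^3 > 0\<close> by (simp add: v_def field_simps)
  then have "(2 * h * cos \<theta>)^3 + (- 3 * h\<^sup>2) * (2 * h * cos \<theta>) + (2 * h^3 - c) = 0"
    by algebra
  then show "u\<^sup>2 * (u + 3 * h) = c"
    using depressed_cubic_shift [of "2 * h * cos \<theta>" h c]
    unfolding u v_def [symmetric] \<theta>_def [symmetric] by simp
qed

section \<open>Nearest points of the paraboloid\<close>

lemma norm_squares_plus_cross_term:
  fixes d e :: "'a::real_inner"
  assumes "\<bar>x\<bar> < 1"
  shows "(norm d)\<^sup>2 + (norm e)\<^sup>2 + 2 * x * inner d e \<ge> 0"
    and "(norm d)\<^sup>2 + (norm e)\<^sup>2 + 2 * x * inner d e = 0 \<Longrightarrow> d = 0 \<and> e = 0"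
proof -
  have eq: "(norm d)\<^sup>2 + (norm e)\<^sup>2 + 2 * x * inner d e
      = (norm (d + x *\<^sub>R e))\<^sup>2 + (1 - x\<^sup>2) * (norm e)\<^sup>2"
    unfolding power2_norm_eq_inner
    by (simp add: inner_simps inner_commute power2_eq_square algebra_simps)
  have "1 - x\<^sup>2 > 0"
    using assms by (simp add: abs_square_less_1)
  then have e: "(1 - x\<^sup>2) * (norm e)\<^sup>2 \<ge> 0"
    by simp
  then show "(norm d)\<^sup>2 + (norm e)\<^sup>2 + 2 * x * inner d e \<ge> 0"
    unfolding eq by simp
  assume "(norm d)\<^sup>2 + (norm e)\<^sup>2 + 2 * x * inner d e = 0"
  then have *: "(norm (d + x *\<^sub>R e))\<^sup>2 = 0 \<and> (1 - x\<^sup>2) * (norm e)\<^sup>2 = 0"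
    unfolding eq using e by (simp add: add_nonneg_eq_0_iff)
  then have "e = 0"
    using \<open>1 - x\<^sup>2 > 0\<close> by auto
  with * show "d = 0 \<and> e = 0"
    by simp
qed

text \<open>
  The displacement \<open>w - s\<close> is \<open>x\<close> times the normal \<open>(y, y, - \<alpha> / \<beta>\<^sup>2)\<close> of the paraboloid at
  \<open>s = (y, y, \<eta>)\<close>, in the weighted inner product. The first-order part of the constraint
  therefore cancels the cross terms in the squared distance, leaving a definite form.
\<close>

lemma wproj_hyp_paraboloid_eq_singleton:
  fixes y :: "'a::real_inner"
  assumes "\<beta> \<noteq> 0" and "\<bar>x\<bar> < 1" and on: "inner y y = \<alpha> * \<eta>"
  shows "wproj \<beta> (hyp_paraboloid \<alpha>) ((1 + x) *\<^sub>R y, (1 + x) *\<^sub>R y, \<eta> - \<alpha> * x / \<beta>\<^sup>2)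
    = {(y, y, \<eta>)}"
proof -
  define s where "s = (y, y, \<eta>)"
  define w where "w = ((1 + x) *\<^sub>R y, (1 + x) *\<^sub>R y, \<eta> - \<alpha> * x / \<beta>\<^sup>2)"
  have key: "wnorm \<beta> (w - s) \<le> wnorm \<beta> (w - t)
      \<and> (wnorm \<beta> (w - t) \<le> wnorm \<beta> (w - s) \<longrightarrow> t = s)"
    if "t \<in> hyp_paraboloid \<alpha>" for t
  proof -
    obtain a b \<tau> where t: "t = (a, b, \<tau>)"
      by (cases t)
    define d where "d = a - y"
    define e where "e = b - y"
    define k where "k = \<tau> - \<eta>"
    define Q where "Q = (norm d)\<^sup>2 + (norm e)\<^sup>2 + 2 * x * inner d e"
    have coords: "a = y + d" "b = y + e" "\<tau> = \<eta> + k"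
      by (simp_all add: d_def e_def k_def)
    have constraint: "inner y d + inner y e + inner d e = \<alpha> * k"
      using that on unfolding t coords hyp_paraboloid_def
      by (simp add: inner_simps inner_commute algebra_simps)
    have diffs: "w - s = (x *\<^sub>R y, x *\<^sub>R y, - (\<alpha> * x / \<beta>\<^sup>2))"
      "w - t = (x *\<^sub>R y - d, x *\<^sub>R y - e, - (\<alpha> * x / \<beta>\<^sup>2) - k)"
      by (simp_all add: w_def s_def t coords algebra_simps)
    have third: "\<beta>\<^sup>2 * (- (\<alpha> * x / \<beta>\<^sup>2) - k)\<^sup>2
        = \<beta>\<^sup>2 * (\<alpha> * x / \<beta>\<^sup>2)\<^sup>2 + 2 * x * (\<alpha> * k) + \<beta>\<^sup>2 * k\<^sup>2"
      using \<open>\<beta> \<noteq> 0\<close> by (simp add: power2_eq_square field_simps)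
    have "(norm (x *\<^sub>R y - d))\<^sup>2 + (norm (x *\<^sub>R y - e))\<^sup>2
        = (norm (x *\<^sub>R y))\<^sup>2 + (norm (x *\<^sub>R y))\<^sup>2 + (norm d)\<^sup>2 + (norm e)\<^sup>2
          - 2 * x * (inner y d + inner y e)"
      unfolding power2_norm_eq_inner
      by (simp add: inner_simps inner_commute algebra_simps)
    also have "inner y d + inner y e = \<alpha> * k - inner d e"
      using constraint by simp
    finally have gap: "(norm (x *\<^sub>R y - d))\<^sup>2 + (norm (x *\<^sub>R y - e))\<^sup>2
          + \<beta>\<^sup>2 * (- (\<alpha> * x / \<beta>\<^sup>2) - k)\<^sup>2
        = (norm (x *\<^sub>R y))\<^sup>2 + (norm (x *\<^sub>R y))\<^sup>2 + \<beta>\<^sup>2 * (- (\<alpha> * x / \<beta>\<^sup>2))\<^sup>2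
          + (Q + \<beta>\<^sup>2 * k\<^sup>2)"
      unfolding third Q_def by (simp add: algebra_simps)
    have le_iff: "wnorm \<beta> (w - s) \<le> wnorm \<beta> (w - t) \<longleftrightarrow> 0 \<le> Q + \<beta>\<^sup>2 * k\<^sup>2"
      "wnorm \<beta> (w - t) \<le> wnorm \<beta> (w - s) \<longleftrightarrow> Q + \<beta>\<^sup>2 * k\<^sup>2 \<le> 0"
      unfolding diffs wnorm_def prod.case real_sqrt_le_iff gap by simp_all
    have "Q \<ge> 0" and Q0: "Q = 0 \<Longrightarrow> d = 0 \<and> e = 0"
      unfolding Q_def using norm_squares_plus_cross_term [OF \<open>\<bar>x\<bar> < 1\<close>] by blast+
    moreover have "\<beta>\<^sup>2 * k\<^sup>2 \<ge> 0"
      by simp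
    moreover have "t = s" if "Q + \<beta>\<^sup>2 * k\<^sup>2 \<le> 0"
    proof -
      have "Q = 0" "\<beta>\<^sup>2 * k\<^sup>2 = 0"
        using that \<open>Q \<ge> 0\<close> \<open>\<beta>\<^sup>2 * k\<^sup>2 \<ge> 0\<close> by linarith+
      with Q0 \<open>\<beta> \<noteq> 0\<close> show ?thesis
        by (simp add: t s_def coords)
    qed
    ultimately show ?thesis
      unfolding le_iff by simp
  qed
  have "s \<in> hyp_paraboloid \<alpha>"
    using on by (simp add: s_def hyp_paraboloid_def)
  then show ?thesis
    unfolding wproj_def s_def [symmetric] w_def [symmetric] using key by blast
qed

section \<open>The projection formula\<close>

theorem theorem7p2:
  fixes z :: "'a::{real_inner, complete_space}"
    and \<alpha> \<beta> \<gamma> \<zeta> p q \<Delta> \<delta> x :: real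
  assumes "\<alpha> \<noteq> 0" and "\<beta> > 0" and "z \<noteq> 0"
    and "\<zeta> = norm z"
    and "\<alpha> * (\<gamma> + \<alpha> / \<beta>\<^sup>2) > \<zeta>\<^sup>2 / 4"
    and "p = - ((\<beta>\<^sup>2 * \<gamma> - \<alpha>)\<^sup>2 / (3 * \<alpha>\<^sup>2))"
    and "q = 2 * (\<beta>\<^sup>2 * \<gamma> - \<alpha>)^3 / (27 * \<alpha>^3) - \<beta>\<^sup>2 * \<zeta>\<^sup>2 / \<alpha>\<^sup>2"
    and "\<Delta> = (p / 3)^3 + (q / 2)\<^sup>2"
    and "\<delta> = sgn (\<alpha>\<^sup>2 - \<alpha> * \<beta>\<^sup>2 * \<gamma>)"
    and "x = (if \<Delta> \<ge> 0
        then - ((2 * \<alpha> + \<beta>\<^sup>2 * \<gamma>) / (3 * \<alpha>))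
             + root 3 (- q / 2 + sqrt \<Delta>) + root 3 (- q / 2 - sqrt \<Delta>)
        else - ((2 * \<alpha> + \<beta>\<^sup>2 * \<gamma>) / (3 * \<alpha>))
             + \<delta> * (2 * (\<alpha> - \<beta>\<^sup>2 * \<gamma>) / (3 * \<alpha>))
               * cos (1 / 3 * ((2 + 2 * \<delta>) * pi
                               + arccos ((- q / 2) / (- p / 3) powr (3 / 2)))))"
  shows "\<Delta> = \<beta>\<^sup>2 * \<zeta>\<^sup>2 / \<alpha>\<^sup>2
             * (\<beta>\<^sup>2 * \<zeta>\<^sup>2 / (4 * \<alpha>\<^sup>2) - (\<beta>\<^sup>2 * \<gamma> - \<alpha>)^3 / (27 * \<alpha>^3))
       \<and> - 1 < x \<and> x < 1
       \<and> wproj \<beta> (hyp_paraboloid \<alpha>) (z, z, \<gamma>)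
           = {(z /\<^sub>R (1 + x), z /\<^sub>R (1 + x), \<gamma> + \<alpha> * x / \<beta>\<^sup>2)}"
proof -
  define h where "h = (\<beta>\<^sup>2 * \<gamma> - \<alpha>) / (3 * \<alpha>)"
  define c where "c = \<beta>\<^sup>2 * \<zeta>\<^sup>2 / \<alpha>\<^sup>2"
  define u where "u = 1 + x"
  have "c > 0"
    using assms(1-4) by (simp add: c_def)
  have h3: "(\<beta>\<^sup>2 * \<gamma> - \<alpha>)^3 / (27 * \<alpha>^3) = h^3"
    by (simp add: h_def power_divide power_mult_distrib)
  have p: "p = - 3 * h\<^sup>2"
    unfolding assms(6) h_def by (simp add: power_divide power_mult_distrib)
  have q: "q = 2 * h^3 - c"
    unfolding assms(7) c_def h3 [symmetric] by simp
  have "(p / 3)^3 = - (h^3)\<^sup>2"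
    by (simp add: p power_mult [symmetric])
  then have \<Delta>: "\<Delta> = c * (c / 4 - h^3)"
    unfolding assms(8) q by (simp add: power2_eq_square field_simps)
  have disc: "\<Delta> = \<beta>\<^sup>2 * \<zeta>\<^sup>2 / \<alpha>\<^sup>2
      * (\<beta>\<^sup>2 * \<zeta>\<^sup>2 / (4 * \<alpha>\<^sup>2) - (\<beta>\<^sup>2 * \<gamma> - \<alpha>)^3 / (27 * \<alpha>^3))"
    unfolding \<Delta> h3 c_def by simp
  have shift: "1 - (2 * \<alpha> + \<beta>\<^sup>2 * \<gamma>) / (3 * \<alpha>) = - h"
    using \<open>\<alpha> \<noteq> 0\<close> by (simp add: h_def field_simps)
  have half_q: "- q / 2 = c / 2 - h^3"
    by (simp add: q)
  have "u > 0 \<and> u\<^sup>2 * (u + 3 * h) = c"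
  proof (cases "\<Delta> \<ge> 0")
    case True
    have "u = root 3 (c / 2 - h^3 + sqrt \<Delta>) + root 3 (c / 2 - h^3 - sqrt \<Delta>) - h"
      using True shift unfolding u_def assms(10) half_q by simp
    then show ?thesis
      using cardano_shifted_root [OF \<open>c > 0\<close> \<Delta> True] by blast
  next
    case False
    then have c_less: "c < 4 * h^3"
      using \<open>c > 0\<close> unfolding \<Delta> by (simp add: mult_less_0_iff not_le)
    with \<open>c > 0\<close> have "h^3 > 0"
      by linarith
    then have "h > 0"
      by (simp add: zero_less_power_eq)
    have "\<alpha>\<^sup>2 - \<alpha> * \<beta>\<^sup>2 * \<gamma> = - (3 * \<alpha>\<^sup>2 * h)"
      using \<open>\<alpha> \<noteq> 0\<close> by (simp add: h_def power2_eq_square field_simps)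
    moreover have "3 * \<alpha>\<^sup>2 * h > 0"
      using \<open>h > 0\<close> \<open>\<alpha> \<noteq> 0\<close> by simp
    ultimately have \<delta>: "\<delta> = - 1"
      unfolding assms(9) by (intro sgn_neg) linarith
    have "(- p / 3) powr (3 / 2) = (h powr 2) powr (3 / 2)"
      using \<open>h > 0\<close> by (simp add: p)
    also have "\<dots> = h^3"
      unfolding powr_powr using \<open>h > 0\<close> by simp
    finally have "(- q / 2) / (- p / 3) powr (3 / 2) = c / (2 * h^3) - 1"
      using \<open>h > 0\<close> unfolding half_q by (simp add: field_simps)
    moreover have "2 * (\<alpha> - \<beta>\<^sup>2 * \<gamma>) / (3 * \<alpha>) = - 2 * h"
      using \<open>\<alpha> \<noteq> 0\<close> by (simp add: h_def field_simps)
    ultimately have "u = 2 * h * cos (arccos (c / (2 * h^3) - 1) / 3) - h"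
      using False shift unfolding u_def assms(10) \<delta> by simp
    then show ?thesis
      using trigonometric_shifted_root [OF \<open>c > 0\<close> c_less \<open>h > 0\<close>] by blast
  qed
  then have "u > 0" and cubic: "u\<^sup>2 * (u + 3 * h) = c"
    by simp_all
  have g: "3 * h + 1 = \<beta>\<^sup>2 * \<gamma> / \<alpha>"
    using \<open>\<alpha> \<noteq> 0\<close> by (simp add: h_def field_simps)
  have "u < 2"
  proof (rule ccontr)
    assume "\<not> u < 2"
    \<comment> \<open>The lower bound on \<open>\<gamma>\<close>, multiplied by \<open>\<beta>\<^sup>2 / \<alpha>\<^sup>2\<close>, compares \<open>c\<close> with the cubic at 2.\<close>
    have "\<beta>\<^sup>2 / \<alpha>\<^sup>2 * (\<zeta>\<^sup>2 / 4) < \<beta>\<^sup>2 / \<alpha>\<^sup>2 * (\<alpha> * (\<gamma> + \<alpha> / \<beta>\<^sup>2))"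
      using assms(1,2,5) by (intro mult_strict_left_mono) auto
    also have "\<dots> = \<beta>\<^sup>2 * \<gamma> / \<alpha> + 1"
      using assms(1,2) by (simp add: power2_eq_square field_simps)
    finally have at_two: "c < 2\<^sup>2 * (2 + 3 * h)"
      unfolding g [symmetric] c_def by simp
    with \<open>c > 0\<close> have "2 + 3 * h > 0"
      by simp
    then have "2\<^sup>2 * (2 + 3 * h) \<le> u\<^sup>2 * (u + 3 * h)"
      using \<open>\<not> u < 2\<close> by (intro mult_mono power_mono) auto
    with at_two cubic show False
      by simp
  qed
  with \<open>u > 0\<close> have x: "- 1 < x" "x < 1"
    by (simp_all add: u_def)
  define y where "y = z /\<^sub>R (1 + x)"
  define \<eta> where "\<eta> = \<gamma> + \<alpha> * x / \<beta>\<^sup>2"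
  have "\<gamma> = \<alpha> * (3 * h + 1) / \<beta>\<^sup>2"
    unfolding g using assms(1,2) by simp
  then have "\<alpha> * \<eta> = \<alpha>\<^sup>2 / \<beta>\<^sup>2 * (u + 3 * h)"
    using \<open>\<beta> > 0\<close> by (simp add: \<eta>_def u_def power2_eq_square field_simps)
  also have "u + 3 * h = c / u\<^sup>2"
    using cubic \<open>u > 0\<close> by (simp add: field_simps)
  also have "\<alpha>\<^sup>2 / \<beta>\<^sup>2 * (c / u\<^sup>2) = (\<zeta> / u)\<^sup>2"
    using assms(1,2) by (simp add: c_def power_divide)
  also have "\<zeta> / u = norm y"
    using \<open>u > 0\<close> by (simp add: y_def u_def assms(4) divide_inverse_commute)
  finally have "inner y y = \<alpha> * \<eta>"
    by (simp add: power2_norm_eq_inner)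
  moreover have "\<bar>x\<bar> < 1" "\<beta> \<noteq> 0"
    using x \<open>\<beta> > 0\<close> by auto
  ultimately have "wproj \<beta> (hyp_paraboloid \<alpha>)
      ((1 + x) *\<^sub>R y, (1 + x) *\<^sub>R y, \<eta> - \<alpha> * x / \<beta>\<^sup>2) = {(y, y, \<eta>)}"
    by (intro wproj_hyp_paraboloid_eq_singleton)
  moreover have "(1 + x) *\<^sub>R y = z" "\<eta> - \<alpha> * x / \<beta>\<^sup>2 = \<gamma>"
    using x by (simp_all add: y_def \<eta>_def)
  ultimately show ?thesis
    using disc x by (simp add: y_def \<eta>_def)
qed

end
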